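(* Let $N\ge1$, let $p\ge1$ be an integer, and let $\Theta=\{\theta^I_j\}$ be a suitable set of moduli of continuity. Consider the topologies $\mathcal T_\Theta$ and $\mathcal T_{\Theta\Theta}$ on $\mathfrak{SC}_p(\mathbb R^{2N},\mathbb R^N)$, and $\sigma_\Theta$ and $\sigma_{\Theta\Theta}$ on $\mathfrak{SC}(\mathbb R^{2N},\mathbb R^N)$. Then $$\mathcal T_\Theta\le\mathcal T_{\Theta\Theta}\qquad\text{and}\qquad\sigma_\Theta\le\sigma_{\Theta\Theta},$$ where $\mathcal T_1\le\mathcal T_2$ means that $\mathcal T_1$ is coarser than (or equal to) $\mathcal T_2$.
   Context: $B_j$ is the closed ball of radius $j$ centered at the origin of the relevant Euclidean space; $C(I,W)$ is the space of continuous functions $I\to W$. $L^p_{loc}$ is the set of real functions on $\mathbb R$ belonging to $L^p(I)$ for every compact interval $I$. $\mathfrak{SC}_p(\mathbb R^{M},\mathbb R^N)$ is the set of functions $f:\mathbb R\times\mathbb R^{M}\to\mathbb R^N$ such that: $f$ is Borel measurable; for every compact $K\subset\mathbb R^{M}$ there is $m^K\in L^p_{loc}$ such that for a.e. $t\in\mathbb R$, $|f(t,x)|\le m^K(t)$ for all $x\in K$; and for a.e. $t\in\mathbb R$ the function $f(t,\cdot)$ is continuous. Functions differing only on a negligible set are identified. The subscript is omitted when $p=1$. A suitable set of moduli of continuity is a countable set $\Theta=\{\theta^I_j: j\in\mathbb N,\ I=[q_1,q_2],\ q_1,q_2\in\mathbb Q\}$ of non-decreasing continuous functions $\theta^I_j:[0,\infty)\to[0,\infty)$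 with $\theta^I_j(0)=0$ and $\theta^{I_1}_{j_1}\le\theta^{I_2}_{j_2}$ whenever $I_1\subseteq I_2$ and $j_1\le j_2$. For $d\in\{N,2N\}$, let $\mathcal K^I_{j,d}$ be the set of $x\in C(I,B_j)$, $B_j\subset\mathbb R^d$, with $|x(t)-x(s)|\le\theta^I_j(|t-s|)$ for all $t,s\in I$. All families of seminorms below are indexed by $I=[q_1,q_2]$, $q_1,q_2\in\mathbb Q$, and $j\in\mathbb N$; $I-1=[q_1-1,q_2-1]$. - $\mathcal T_\Theta$: $\sup_{x\in\mathcal K^I_{j,2N}}\left[\int_I|f(t,x(t))|^pdt\right]^{1/p}$. - $\sigma_\Theta$: $\sup_{x\in\mathcal K^I_{j,2N}}\left|\int_I f(t,x(t))\,dt\right|$. - $\mathcal T_{\Theta\Theta}$: $\sup_{x\in\mathcal K^I_{j,N},\,u\in\mathcal K^{I-1}_{j,N}}\left[\int_I|f(t,x(t),u(t-1))|^pdt\right]^{1/p}$. - $\sigma_{\Theta\Theta}$: $\sup_{x\in\mathcal K^I_{j,N},\,u\in\mathcal K^{I-1}_{j,N}}\left|\int_I f(t,x(t),u(t-1))\,dt\right|$. *)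

theory Defs
  imports "HOL-Analysis.Analysis"
begin

definition Lp_loc :: "nat \<Rightarrow> (real \<Rightarrow> real) set" where
  "Lp_loc p = {m. \<forall>a b. m \<in> borel_measurable (lebesgue_on {a..b}) \<and>
                        integrable (lebesgue_on {a..b}) (\<lambda>t. \<bar>m t\<bar> ^ p)}"

definition SC :: "nat \<Rightarrow> (real \<times> 'a::euclidean_space \<Rightarrow> 'b::euclidean_space) set" where
  "SC p = {f. f \<in> borel_measurable borel \<and>
              (\<forall>K. compact K \<longrightarrow>
                 (\<exists>m\<in>Lp_loc p. AE t in lborel. \<forall>x\<in>K. norm (f (t, x)) \<le> m t)) \<and>
              (AE t in lborel. continuous_on UNIV (\<lambda>x. f (t, x)))}"

definition SC_eq ::
  "nat \<Rightarrow> ((real \<times> 'a::euclidean_space \<Rightarrow> 'b::euclidean_space) \<times> (real \<times> 'a \<Rightarrow> 'b)) set" where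
  "SC_eq p = {(f, g). f \<in> SC p \<and> g \<in> SC p \<and> negligible {z. f z \<noteq> g z}}"

definition SC_space :: "nat \<Rightarrow> (real \<times> 'a::euclidean_space \<Rightarrow> 'b::euclidean_space) set set" where
  "SC_space p = SC p // SC_eq p"

definition rational_intervals :: "real set set" where
  "rational_intervals = {{q1..q2} | q1 q2. q1 \<in> \<rat> \<and> q2 \<in> \<rat> \<and> q1 \<le> q2}"

text \<open>Moduli are total functions on the reals; only their values on the half-line
  \<open>{0..}\<close> and at rational intervals are constrained or used.\<close>

definition suitable_moduli :: "(real set \<Rightarrow> nat \<Rightarrow> real \<Rightarrow> real) \<Rightarrow> bool" where
  "suitable_moduli \<theta> \<longleftrightarrow>
     (\<forall>I\<in>rational_intervals. \<forall>j.
        \<theta> I j ` {0..} \<subseteq> {0..} \<and> mono_on {0..} (\<theta> I j) \<and>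
        continuous_on {0..} (\<theta> I j) \<and> \<theta> I j 0 = 0) \<and>
     (\<forall>I1\<in>rational_intervals. \<forall>I2\<in>rational_intervals. \<forall>j1 j2.
        I1 \<subseteq> I2 \<longrightarrow> j1 \<le> j2 \<longrightarrow> (\<forall>s\<ge>0. \<theta> I1 j1 s \<le> \<theta> I2 j2 s))"

text \<open>Functions on \<open>I\<close> are represented by total functions whose values off \<open>I\<close> are arbitrary;
  every seminorm below only evaluates them on \<open>I\<close>.\<close>

definition modulus_set ::
  "(real set \<Rightarrow> nat \<Rightarrow> real \<Rightarrow> real) \<Rightarrow> real set \<Rightarrow> nat \<Rightarrow> (real \<Rightarrow> 'a::euclidean_space) set" where
  "modulus_set \<theta> I j = {x. continuous_on I x \<and> x ` I \<subseteq> cball 0 (real j) \<and>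
                           (\<forall>t\<in>I. \<forall>s\<in>I. norm (x t - x s) \<le> \<theta> I j \<bar>t - s\<bar>)}"

abbreviation shift_back :: "real set \<Rightarrow> real set" where
  "shift_back I \<equiv> (\<lambda>t. t - 1) ` I"

text \<open>The space \<open>\<real>\<^sup>2\<^sup>N\<close> is the product \<open>'a \<times> 'a\<close>, whose norm is the Euclidean one. For functions in
  \<open>SC p\<close> all the suprema below are over nonempty sets that are bounded above, so they agree with
  the suprema in the extended reals.\<close>

definition seminorm_T ::
  "(real set \<Rightarrow> nat \<Rightarrow> real \<Rightarrow> real) \<Rightarrow> nat \<Rightarrow> real set \<Rightarrow> nat \<Rightarrow>
   (real \<times> 'a::euclidean_space \<times> 'a \<Rightarrow> 'b::euclidean_space) \<Rightarrow> real" where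
  "seminorm_T \<theta> p I j f =
     (SUP x\<in>modulus_set \<theta> I j. root p (LINT t:I|lborel. norm (f (t, x t)) ^ p))"

definition seminorm_sigma ::
  "(real set \<Rightarrow> nat \<Rightarrow> real \<Rightarrow> real) \<Rightarrow> real set \<Rightarrow> nat \<Rightarrow>
   (real \<times> 'a::euclidean_space \<times> 'a \<Rightarrow> 'b::euclidean_space) \<Rightarrow> real" where
  "seminorm_sigma \<theta> I j f =
     (SUP x\<in>modulus_set \<theta> I j. norm (LINT t:I|lborel. f (t, x t)))"

definition seminorm_TT ::
  "(real set \<Rightarrow> nat \<Rightarrow> real \<Rightarrow> real) \<Rightarrow> nat \<Rightarrow> real set \<Rightarrow> nat \<Rightarrow>
   (real \<times> 'a::euclidean_space \<times> 'a \<Rightarrow> 'b::euclidean_space) \<Rightarrow> real" where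
  "seminorm_TT \<theta> p I j f =
     (SUP (x, u)\<in>modulus_set \<theta> I j \<times> modulus_set \<theta> (shift_back I) j.
        root p (LINT t:I|lborel. norm (f (t, x t, u (t - 1))) ^ p))"

definition seminorm_sigma_sigma ::
  "(real set \<Rightarrow> nat \<Rightarrow> real \<Rightarrow> real) \<Rightarrow> real set \<Rightarrow> nat \<Rightarrow>
   (real \<times> 'a::euclidean_space \<times> 'a \<Rightarrow> 'b::euclidean_space) \<Rightarrow> real" where
  "seminorm_sigma_sigma \<theta> I j f =
     (SUP (x, u)\<in>modulus_set \<theta> I j \<times> modulus_set \<theta> (shift_back I) j.
        norm (LINT t:I|lborel. f (t, x t, u (t - 1))))"

text \<open>Points are equivalence classes of functions. A seminorm \<open>\<rho>\<close> is given on functions and descends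
  to classes when it is invariant under the identification, as shown below for the four families;
  then the choice of representatives in the following definition is immaterial.\<close>

definition class_ball ::
  "('z \<Rightarrow> 'b::real_vector) set set \<Rightarrow> (('z \<Rightarrow> 'b) \<Rightarrow> real) \<Rightarrow> ('z \<Rightarrow> 'b) set \<Rightarrow> real \<Rightarrow>
   ('z \<Rightarrow> 'b) set set" where
  "class_ball V \<rho> F e = {G \<in> V. \<exists>f\<in>F. \<exists>g\<in>G. \<rho> (\<lambda>z. g z - f z) < e}"

definition seminorm_topology ::
  "('z \<Rightarrow> 'b::real_vector) set set \<Rightarrow> (('z \<Rightarrow> 'b) \<Rightarrow> real) set \<Rightarrow> ('z \<Rightarrow> 'b) set topology" where
  "seminorm_topology V P =
     topology_generated_by {class_ball V \<rho> F e | \<rho> F e. \<rho> \<in> P \<and> F \<in> V \<and> e > 0}"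

definition T_Theta ::
  "(real set \<Rightarrow> nat \<Rightarrow> real \<Rightarrow> real) \<Rightarrow> nat \<Rightarrow>
   (real \<times> 'a::euclidean_space \<times> 'a \<Rightarrow> 'b::euclidean_space) set topology" where
  "T_Theta \<theta> p =
     seminorm_topology (SC_space p) {seminorm_T \<theta> p I j | I j. I \<in> rational_intervals}"

definition T_ThetaTheta ::
  "(real set \<Rightarrow> nat \<Rightarrow> real \<Rightarrow> real) \<Rightarrow> nat \<Rightarrow>
   (real \<times> 'a::euclidean_space \<times> 'a \<Rightarrow> 'b::euclidean_space) set topology" where
  "T_ThetaTheta \<theta> p =
     seminorm_topology (SC_space p) {seminorm_TT \<theta> p I j | I j. I \<in> rational_intervals}"

definition sigma_Theta ::
  "(real set \<Rightarrow> nat \<Rightarrow> real \<Rightarrow> real) \<Rightarrow>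
   (real \<times> 'a::euclidean_space \<times> 'a \<Rightarrow> 'b::euclidean_space) set topology" where
  "sigma_Theta \<theta> =
     seminorm_topology (SC_space 1) {seminorm_sigma \<theta> I j | I j. I \<in> rational_intervals}"

definition sigma_ThetaTheta ::
  "(real set \<Rightarrow> nat \<Rightarrow> real \<Rightarrow> real) \<Rightarrow>
   (real \<times> 'a::euclidean_space \<times> 'a \<Rightarrow> 'b::euclidean_space) set topology" where
  "sigma_ThetaTheta \<theta> =
     seminorm_topology (SC_space 1) {seminorm_sigma_sigma \<theta> I j | I j. I \<in> rational_intervals}"

definition coarser :: "'c topology \<Rightarrow> 'c topology \<Rightarrow> bool" where
  "coarser S T \<longleftrightarrow> topspace S = topspace T \<and> (\<forall>U. openin S U \<longrightarrow> openin T U)"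

lemma SC_eq_equiv:
  "equiv (SC p) (SC_eq p :: ((real \<times> 'a::euclidean_space \<Rightarrow> 'b::euclidean_space) \<times> _) set)"
  (is "equiv _ ?R")
proof (rule equivI)
  show "refl_on (SC p) ?R" by (auto simp: refl_on_def SC_eq_def)
  show "sym ?R" by (auto simp: sym_def SC_eq_def eq_commute)
  show "trans ?R"
  proof (rule transI)
    fix f g h :: "real \<times> 'a \<Rightarrow> 'b"
    assume fg: "(f, g) \<in> ?R" and gh: "(g, h) \<in> ?R"
    have "negligible ({z. f z \<noteq> g z} \<union> {z. g z \<noteq> h z})"
      using fg gh by (intro negligible_Un) (auto simp: SC_eq_def)
    then have "negligible {z. f z \<noteq> h z}"
      by (rule negligible_subset) auto
    with fg gh show "(f, h) \<in> ?R"
      by (simp add: SC_eq_def)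
  qed
  show "?R \<subseteq> SC p \<times> SC p" by (auto simp: SC_eq_def)
qed

lemma SC_eq_imp_AE_eq:
  fixes f g :: "real \<times> 'a::euclidean_space \<Rightarrow> 'b::euclidean_space"
  assumes "(f, g) \<in> SC_eq p"
  shows "AE t in lborel. \<forall>x. f (t, x) = g (t, x)"
proof -
  have f: "f \<in> borel_measurable borel" "AE t in lborel. continuous_on UNIV (\<lambda>x. f (t, x))"
    and g: "g \<in> borel_measurable borel" "AE t in lborel. continuous_on UNIV (\<lambda>x. g (t, x))"
    and n: "negligible {z. f z \<noteq> g z}"
    using assms by (auto simp: SC_eq_def SC_def)
  have "AE z in lebesgue. f z = g z"
    using n AE_iff_null_sets[of "{z. f z \<noteq> g z}" lebesgue]
    by (auto simp: negligible_iff_null_sets)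
  then have "AE z in lborel. f z = g z"
    by (simp add: AE_completion_iff)
  then have "AE z in (lborel :: real measure) \<Otimes>\<^sub>M (lborel :: 'a measure). f z = g z"
    unfolding lborel_prod .
  then have "AE t in (lborel :: real measure). AE x in (lborel :: 'a measure). f (t, x) = g (t, x)"
    by (rule lborel_pair.AE_pair)
  with f(2) g(2) show ?thesis
  proof eventually_elim
    case (elim t)
    have "open {x. f (t, x) \<noteq> g (t, x)}"
      using elim by (intro open_Collect_neq) auto
    moreover from this have "{x. f (t, x) \<noteq> g (t, x)} \<in> null_sets lborel"
      using elim(3) AE_iff_null_sets[of "{x. f (t, x) \<noteq> g (t, x)}" lborel] by auto
    then have "negligible {x. f (t, x) \<noteq> g (t, x)}"
      by (simp add: negligible_iff_null_sets null_sets_completionI)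
    ultimately have "{x. f (t, x) \<noteq> g (t, x)} = {}"
      using open_not_negligible by blast
    then show ?case by auto
  qed
qed

lemma AE_eq_imp_LINT_eq:
  fixes f g :: "real \<times> 'a::euclidean_space \<Rightarrow> 'b::euclidean_space"
    and h :: "'b \<Rightarrow> 'c::euclidean_space"
  assumes [measurable]: "f \<in> borel_measurable borel" "g \<in> borel_measurable borel"
    "h \<in> borel_measurable borel"
    and eq: "AE t in lborel. \<forall>x. f (t, x) = g (t, x)"
    and I: "I \<in> rational_intervals" and y: "continuous_on I y"
  shows "(LINT t:I|lborel. h (f (t, y t))) = (LINT t:I|lborel. h (g (t, y t)))"
proof -
  have [measurable]: "I \<in> sets borel" using I by (auto simp: rational_intervals_def)
  have [measurable]: "(\<lambda>t. indicator I t *\<^sub>R y t) \<in> borel_measurable borel"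
    using y by (intro borel_measurable_continuous_on_indicator) auto
  have meas: "(\<lambda>t. indicator I t *\<^sub>R h (k (t, y t))) \<in> borel_measurable lborel"
    if [measurable]: "k \<in> borel_measurable borel" for k :: "real \<times> 'a \<Rightarrow> 'b"
  proof -
    have [measurable]: "(\<lambda>t. (t, indicator I t *\<^sub>R y t)) \<in> borel \<rightarrow>\<^sub>M borel"
      by (intro borel_measurable_Pair) auto
    have "(\<lambda>t. indicator I t *\<^sub>R h (k (t, indicator I t *\<^sub>R y t))) \<in> borel_measurable borel"
      by measurable
    also have "(\<lambda>t. indicator I t *\<^sub>R h (k (t, indicator I t *\<^sub>R y t))) =
               (\<lambda>t. indicator I t *\<^sub>R h (k (t, y t)))"
      by (auto simp: indicator_def)
    finally show ?thesis by simp
  qed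
  show ?thesis
    unfolding set_lebesgue_integral_def
    by (intro integral_cong_AE meas assms) (use eq in eventually_elim, simp)
qed

lemma seminorms_independent:
  fixes F G :: "(real \<times> 'a::euclidean_space \<times> 'a \<Rightarrow> 'b::euclidean_space) set"
  assumes F: "F \<in> SC_space q" "f \<in> F" "f' \<in> F" and G: "G \<in> SC_space q" "g \<in> G" "g' \<in> G"
    and I: "I \<in> rational_intervals"
  shows "seminorm_T \<theta> p I j (\<lambda>z. g z - f z) = seminorm_T \<theta> p I j (\<lambda>z. g' z - f' z)" (is ?A)
    and "seminorm_TT \<theta> p I j (\<lambda>z. g z - f z) = seminorm_TT \<theta> p I j (\<lambda>z. g' z - f' z)" (is ?B)
    and "seminorm_sigma \<theta> I j (\<lambda>z. g z - f z) = seminorm_sigma \<theta> I j (\<lambda>z. g' z - f' z)" (is ?C)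
    and "seminorm_sigma_sigma \<theta> I j (\<lambda>z. g z - f z) =
         seminorm_sigma_sigma \<theta> I j (\<lambda>z. g' z - f' z)" (is ?D)
proof -
  have r: "(f, f') \<in> SC_eq q" "(g, g') \<in> SC_eq q"
    using F G in_quotient_imp_in_rel[OF SC_eq_equiv] by (auto simp: SC_space_def)
  then have [measurable]: "f \<in> borel_measurable borel" "f' \<in> borel_measurable borel"
    "g \<in> borel_measurable borel" "g' \<in> borel_measurable borel"
    by (auto simp: SC_eq_def SC_def)
  have meas: "(\<lambda>z. g z - f z) \<in> borel_measurable borel" "(\<lambda>z. g' z - f' z) \<in> borel_measurable borel"
    by measurable
  have "AE t in lborel. \<forall>x. g (t, x) - f (t, x) = g' (t, x) - f' (t, x)"
    using SC_eq_imp_AE_eq[OF r(1)] SC_eq_imp_AE_eq[OF r(2)] by eventually_elim auto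
  note eq = AE_eq_imp_LINT_eq[OF meas _ this I]
  have pair: "continuous_on I (\<lambda>t. (x t, u (t - 1)))"
    if "x \<in> modulus_set \<theta> I j" "u \<in> modulus_set \<theta> (shift_back I) j" for x u :: "real \<Rightarrow> 'a"
    using that unfolding modulus_set_def
    by (auto intro!: continuous_intros continuous_on_compose2[where f="\<lambda>t. t - 1" and g=u])
  show ?A ?C
    unfolding seminorm_T_def seminorm_sigma_def
    by (auto intro!: SUP_cong arg_cong[where f="root p"] arg_cong[where f=norm]
        eq[where h="\<lambda>v. norm v ^ p"] eq[where h="\<lambda>v. v"] simp: modulus_set_def)
  show ?B ?D
    unfolding seminorm_TT_def seminorm_sigma_sigma_def
    by (auto intro!: SUP_cong arg_cong[where f="root p"] arg_cong[where f=norm]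
        eq[where h="\<lambda>v. norm v ^ p"] eq[where h="\<lambda>v. v"] pair)
qed

end

theory Submission
  imports Defs
begin

text \<open>The delayed modulus set on \<open>[a - 1, b - 1]\<close> is governed by a modulus unrelated to the one on
  \<open>[a, b]\<close>, so one passes to \<open>[a, b + 1]\<close>, extending \<open>x\<close> on \<open>[a, b]\<close> by its final value; by
  monotonicity of the moduli both components are then admissible. The \<open>L\<^sup>p\<close> seminorm only grows
  with the interval. For the \<open>\<sigma>\<close> seminorm the excess over \<open>[b, b + 1]\<close> is the integral along a
  constant, hence bounded by a second seminorm of the delayed family.\<close>

section \<open>Comparison of topologies generated by seminorm balls on classes\<close>

text \<open>A \<open>P\<close>-ball is open for \<open>Q\<close> because around each of its points
  fits an intersection of two \<open>Q\<close>-balls, one for each seminorm in the dominating sum.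
  Allowing two dominating seminorms is what the \<sigma> case requires. The triangle inequality is
  asked only of \<open>P\<close>, since only a seminorm from \<open>P\<close> is split along an
  intermediate point.\<close>

lemma seminorm_topology_coarser:
  fixes V :: "('z \<Rightarrow> 'b::real_vector) set set"
  assumes ne: "\<And>F. F \<in> V \<Longrightarrow> F \<noteq> {}"
    and indep: "\<And>\<rho> F G f f' g g'. \<rho> \<in> P \<union> Q \<Longrightarrow> F \<in> V \<Longrightarrow> f \<in> F \<Longrightarrow> f' \<in> F \<Longrightarrow>
      G \<in> V \<Longrightarrow> g \<in> G \<Longrightarrow> g' \<in> G \<Longrightarrow> \<rho> (\<lambda>z. g z - f z) = \<rho> (\<lambda>z. g' z - f' z)"
    and zero: "\<And>\<rho>. \<rho> \<in> P \<union> Q \<Longrightarrow> \<rho> (\<lambda>z. 0) = 0"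
    and triangle: "\<And>\<rho> f g h. \<rho> \<in> P \<Longrightarrow> f \<in> \<Union>V \<Longrightarrow> g \<in> \<Union>V \<Longrightarrow> h \<in> \<Union>V \<Longrightarrow>
      \<rho> (\<lambda>z. h z - f z) \<le> \<rho> (\<lambda>z. h z - g z) + \<rho> (\<lambda>z. g z - f z)"
    and dominated: "\<And>\<rho>. \<rho> \<in> P \<Longrightarrow> \<exists>\<sigma>\<in>Q. \<exists>\<tau>\<in>Q. \<forall>f\<in>\<Union>V. \<forall>g\<in>\<Union>V.
      \<rho> (\<lambda>z. g z - f z) \<le> \<sigma> (\<lambda>z. g z - f z) + \<tau> (\<lambda>z. g z - f z)"
    and "P \<noteq> {}" "Q \<noteq> {}"
  shows "coarser (seminorm_topology V P) (seminorm_topology V Q)"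
proof -
  let ?B = "\<lambda>R. {class_ball V \<rho> F e | \<rho> F e. \<rho> \<in> R \<and> F \<in> V \<and> e > 0}"
  have centre: "F \<in> class_ball V \<rho> F e" if "\<rho> \<in> P \<union> Q" "F \<in> V" "e > 0" for \<rho> F e
  proof -
    obtain f where "f \<in> F" using ne[OF \<open>F \<in> V\<close>] by blast
    moreover have "\<rho> (\<lambda>z. f z - f z) < e" using zero[OF that(1)] that(3) by simp
    ultimately show ?thesis using that unfolding class_ball_def by blast
  qed
  \<comment> \<open>\<open>coarser\<close> also demands equal carriers. Both are \<open>V\<close>,
    because each class lies in the ball around itself.\<close>
  have top: "\<Union>(?B R) = V" if "R \<noteq> {}" "R \<subseteq> P \<union> Q" for R
  proof
    show "\<Union>(?B R) \<subseteq> V" by (auto simp: class_ball_def)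
    obtain \<rho> where "\<rho> \<in> R" using \<open>R \<noteq> {}\<close> by blast
    show "V \<subseteq> \<Union>(?B R)"
    proof
      fix F assume "F \<in> V"
      then have "F \<in> class_ball V \<rho> F 1"
        using \<open>\<rho> \<in> R\<close> \<open>R \<subseteq> P \<union> Q\<close> by (intro centre) auto
      moreover have "class_ball V \<rho> F 1 \<in> ?B R"
        using \<open>F \<in> V\<close> \<open>\<rho> \<in> R\<close> zero_less_one by blast
      ultimately show "F \<in> \<Union>(?B R)" by (rule UnionI[rotated])
    qed
  qed
  have ball: "openin (seminorm_topology V Q) (class_ball V \<rho> F e)"
    if \<rho>: "\<rho> \<in> P" and F: "F \<in> V" and "e > 0" for \<rho> F e
  proof (subst openin_subopen, intro ballI)
    fix G assume "G \<in> class_ball V \<rho> F e"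
    then obtain f g where G: "G \<in> V" and f: "f \<in> F" and g: "g \<in> G"
      and less: "\<rho> (\<lambda>z. g z - f z) < e"
      by (auto simp: class_ball_def)
    obtain \<sigma> \<tau> where st: "\<sigma> \<in> Q" "\<tau> \<in> Q"
      and le: "\<forall>f\<in>\<Union>V. \<forall>g\<in>\<Union>V.
        \<rho> (\<lambda>z. g z - f z) \<le> \<sigma> (\<lambda>z. g z - f z) + \<tau> (\<lambda>z. g z - f z)"
      using dominated[OF \<rho>] by (elim bexE) (rule that)
    \<comment> \<open>Half of the slack left at \<open>G\<close>: two seminorms below
      \<open>d\<close> add up to less than what separates
      \<open>\<rho> (\<lambda>z. g z - f z)\<close> from \<open>e\<close>.\<close>
    define d where "d = (e - \<rho> (\<lambda>z. g z - f z)) / 2"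
    have "d > 0" using less by (simp add: d_def)
    let ?U = "class_ball V \<sigma> G d \<inter> class_ball V \<tau> G d"
    have "openin (seminorm_topology V Q) ?U"
      unfolding seminorm_topology_def using st G \<open>d > 0\<close>
      by (intro openin_Int topology_generated_by_Basis) blast+
    moreover have "G \<in> ?U"
      using centre st G \<open>d > 0\<close> by auto
    moreover have "?U \<subseteq> class_ball V \<rho> F e"
    proof
      fix H assume H: "H \<in> ?U"
      then have HV: "H \<in> V" by (simp add: class_ball_def)
      then obtain h where h: "h \<in> H" using ne by blast
      \<comment> \<open>Membership in a ball provides only some representatives \<open>g'\<close>
        and \<open>h'\<close>. Independence of representatives carries the estimate over to the
        fixed \<open>g\<close> and \<open>h\<close>, so that all three differences in the triangle
        inequality use the same functions.\<close>
      have "\<kappa> (\<lambda>z. h z - g z) < d" if \<kappa>: "\<kappa> \<in> Q" "H \<in> class_ball V \<kappa> G d" for \<kappa>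
      proof -
        obtain g' h' where gh: "g' \<in> G" "h' \<in> H" and "\<kappa> (\<lambda>z. h' z - g' z) < d"
          using \<kappa>(2) unfolding class_ball_def by blast
        moreover have "\<kappa> (\<lambda>z. h z - g z) = \<kappa> (\<lambda>z. h' z - g' z)"
          by (rule indep[OF _ G g gh(1) HV h gh(2)]) (simp add: \<kappa>(1))
        ultimately show ?thesis by simp
      qed
      then have "\<sigma> (\<lambda>z. h z - g z) < d" "\<tau> (\<lambda>z. h z - g z) < d"
        using st H by auto
      moreover have "f \<in> \<Union>V" "g \<in> \<Union>V" "h \<in> \<Union>V" using F G HV f g h by auto
      ultimately have "\<rho> (\<lambda>z. h z - f z) < e"
        using triangle[OF \<rho>, of f g h] le[rule_format, of g h] by (simp add: d_def)
      then show "H \<in> class_ball V \<rho> F e"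
        using HV f h by (auto simp: class_ball_def)
    qed
    ultimately show "\<exists>T. openin (seminorm_topology V Q) T \<and> G \<in> T \<and> T \<subseteq> class_ball V \<rho> F e"
      by blast
  qed
  have "openin (seminorm_topology V Q) U" if "openin (seminorm_topology V P) U" for U
  proof -
    have "generate_topology_on (?B P) U"
      using that by (simp add: seminorm_topology_def openin_topology_generated_by_iff)
    then show ?thesis
      by induction (auto intro: ball)
  qed
  then show ?thesis
    using top[of P] top[of Q] assms by (simp add: coarser_def seminorm_topology_def)
qed

section \<open>Minkowski's inequality\<close>

text \<open>With \<open>a\<close> and \<open>b\<close> slightly above the two norms and
  \<open>c = a + b\<close>, the quotient \<open>(norm (f t) + norm (g t)) / c\<close> is the convex
  combination of \<open>norm (f t) / a\<close> and \<open>norm (g t) / b\<close> with weights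
  \<open>a / c\<close> and \<open>b / c\<close>. Convexity of the power bounds its
  \<open>p\<close>-th power, and each normalised integral is at most 1.\<close>

lemma Minkowski_set_integral:
  fixes f g :: "'c \<Rightarrow> 'b::real_normed_vector"
  assumes p: "p \<ge> 1"
    and f: "set_integrable M A (\<lambda>t. norm (f t) ^ p)"
    and g: "set_integrable M A (\<lambda>t. norm (g t) ^ p)"
  shows "root p (LINT t:A|M. norm (f t + g t) ^ p) \<le>
    root p (LINT t:A|M. norm (f t) ^ p) + root p (LINT t:A|M. norm (g t) ^ p)"
proof (rule field_le_epsilon)
  let ?F = "LINT t:A|M. norm (f t) ^ p" and ?G = "LINT t:A|M. norm (g t) ^ p"
  fix e :: real assume "e > 0"
  \<comment> \<open>The extra \<open>e / 2\<close> keeps both numbers positive, so that division by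
    them is possible even when a norm vanishes.\<close>
  define a b where "a = root p ?F + e / 2" and "b = root p ?G + e / 2"
  have F0: "?F \<ge> 0" "?G \<ge> 0"
    by (auto simp: set_lebesgue_integral_def intro!: integral_nonneg_AE)
  then have ab: "a > 0" "b > 0"
    using \<open>e > 0\<close> p by (auto simp: a_def b_def intro!: add_nonneg_pos)
  have "root p ?F \<le> a" "root p ?G \<le> b"
    using \<open>e > 0\<close> by (auto simp: a_def b_def)
  then have "(root p ?F) ^ p \<le> a ^ p" "(root p ?G) ^ p \<le> b ^ p"
    using power_mono[OF _ real_root_ge_zero[OF F0(1)]] power_mono[OF _ real_root_ge_zero[OF F0(2)]]
    by blast+
  then have Fa: "?F \<le> a ^ p" "?G \<le> b ^ p"
    using p F0 by (auto simp: real_root_pow_pos2)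
  define c where "c = a + b"
  have c: "c > 0" using ab by (simp add: c_def)
  let ?h = "\<lambda>t. c ^ p * (a / c * (norm (f t) ^ p / a ^ p) + b / c * (norm (g t) ^ p / b ^ p))"
  have pointwise: "norm (f t + g t) ^ p \<le> ?h t" for t
  proof -
    have conv: "convex_on {0::real..} (\<lambda>x. x ^ p)"
      using convex_on_subset[OF convex_power_even] convex_power_odd by (cases "even p") auto
    have "a / c * (norm (f t) / a) + b / c * (norm (g t) / b) = (norm (f t) + norm (g t)) / c"
      using ab by (simp add: add_divide_distrib)
    moreover have "1 - b / c = a / c"
      using c by (simp add: c_def divide_simps)
    then have "(a / c * (norm (f t) / a) + b / c * (norm (g t) / b)) ^ p
        \<le> a / c * (norm (f t) / a) ^ p + b / c * (norm (g t) / b) ^ p"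
      using ab c convex_onD[OF conv, of "b / c" "norm (f t) / a" "norm (g t) / b"]
      by (simp add: c_def)
    ultimately have "((norm (f t) + norm (g t)) / c) ^ p
        \<le> a / c * (norm (f t) / a) ^ p + b / c * (norm (g t) / b) ^ p"
      by simp
    then have "(norm (f t) + norm (g t)) ^ p \<le> ?h t"
      using c by (simp add: power_divide pos_divide_le_eq mult.commute)
    moreover have "norm (f t + g t) ^ p \<le> (norm (f t) + norm (g t)) ^ p"
      by (intro power_mono norm_triangle_ineq) auto
    ultimately show ?thesis by linarith
  qed
  have int: "set_integrable M A ?h"
    using f g by (intro set_integrable_mult_right set_integral_add set_integrable_divide) auto
  \<comment> \<open>Integrability of the left integrand is not established here. Were it to fail,
    the integral would be 0 by convention, still below the integral of the nonnegative
    \<open>?h\<close>.\<close>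
  have "(LINT t:A|M. norm (f t + g t) ^ p) \<le> (LINT t:A|M. ?h t)"
    unfolding set_lebesgue_integral_def using pointwise int ab c
    by (intro integral_mono_AE') (auto simp: set_integrable_def indicator_def)
  also have "\<dots> = c ^ p * (a / c * (?F / a ^ p) + b / c * (?G / b ^ p))"
    using f g by (simp add: set_integral_add set_integrable_divide set_integrable_mult_right)
  also have "\<dots> \<le> c ^ p * (a / c * 1 + b / c * 1)"
    using ab c Fa by (intro mult_left_mono add_mono) auto
  also have "a / c * 1 + b / c * 1 = 1"
    using c by (simp add: c_def flip: add_divide_distrib)
  finally have "root p (LINT t:A|M. norm (f t + g t) ^ p) \<le> root p (c ^ p)"
    using p by (simp only: mult_1_right real_root_le_iff)
  also have "\<dots> = c" using p c by (simp add: real_root_power_cancel)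
  finally show "root p (LINT t:A|M. norm (f t + g t) ^ p) \<le> root p ?F + root p ?G + e"
    by (simp add: c_def a_def b_def)
qed

section \<open>Differences of functions in \<open>SC\<close> and superposition with curves\<close>

lemma Lp_loc_add:
  assumes "m \<in> Lp_loc p" "n \<in> Lp_loc p"
  shows "(\<lambda>t. m t + n t) \<in> Lp_loc p"
proof -
  have "integrable (lebesgue_on {a..b}) (\<lambda>t. \<bar>m t + n t\<bar> ^ p)" for a b
  proof (rule Bochner_Integration.integrable_bound)
    have meas [measurable]: "m \<in> borel_measurable (lebesgue_on {a..b})"
        "n \<in> borel_measurable (lebesgue_on {a..b})"
      using assms by (auto simp: Lp_loc_def)
    show "integrable (lebesgue_on {a..b}) (\<lambda>t. 2 ^ p * (\<bar>m t\<bar> ^ p + \<bar>n t\<bar> ^ p))"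
      using assms by (auto simp: Lp_loc_def)
    show "(\<lambda>t. \<bar>m t + n t\<bar> ^ p) \<in> borel_measurable (lebesgue_on {a..b})"
      by measurable
    \<comment> \<open>A sum is at most twice the larger summand in absolute value. This crude
      constant is enough, since only integrability is at stake.\<close>
    have "\<bar>m t + n t\<bar> ^ p \<le> 2 ^ p * (\<bar>m t\<bar> ^ p + \<bar>n t\<bar> ^ p)" for t
    proof -
      have "\<bar>m t + n t\<bar> ^ p \<le> (2 * max \<bar>m t\<bar> \<bar>n t\<bar>) ^ p"
        by (intro power_mono) auto
      also have "\<dots> = 2 ^ p * max \<bar>m t\<bar> \<bar>n t\<bar> ^ p"
        by (rule power_mult_distrib)
      also have "\<dots> \<le> 2 ^ p * (\<bar>m t\<bar> ^ p + \<bar>n t\<bar> ^ p)"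
        by (auto simp: max_def)
      finally show ?thesis .
    qed
    then show "AE t in lebesgue_on {a..b}. norm (\<bar>m t + n t\<bar> ^ p)
        \<le> norm (2 ^ p * (\<bar>m t\<bar> ^ p + \<bar>n t\<bar> ^ p))"
      by (intro AE_I2) (auto intro: order_trans)
  qed
  moreover have "(\<lambda>t. m t + n t) \<in> borel_measurable (lebesgue_on {a..b})" for a b
    using assms by (intro borel_measurable_add) (auto simp: Lp_loc_def)
  ultimately show ?thesis
    by (simp add: Lp_loc_def)
qed

lemma SC_bound:
  assumes "f \<in> SC p" "compact K"
  shows "\<exists>m\<in>Lp_loc p. AE t in lborel. \<forall>x\<in>K. norm (f (t, x)) \<le> m t"
  using assms by (simp add: SC_def)

text \<open>Balls are measured through differences of representatives, so the seminorm estimates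
  have to be applicable to them. The sum of the two dominating functions dominates the
  difference.\<close>

lemma SC_diff:
  assumes f: "f \<in> SC p" and g: "g \<in> SC p"
  shows "(\<lambda>z. g z - f z) \<in> SC p"
proof -
  have [measurable]: "f \<in> borel_measurable borel" "g \<in> borel_measurable borel"
    using assms by (auto simp: SC_def)
  have "\<exists>m\<in>Lp_loc p. AE t in lborel. \<forall>x\<in>K. norm (g (t, x) - f (t, x)) \<le> m t"
    if K: "compact K" for K
  proof -
    obtain m where m: "m \<in> Lp_loc p" "AE t in lborel. \<forall>x\<in>K. norm (f (t, x)) \<le> m t"
      using SC_bound[OF f K] by blast
    obtain n where n: "n \<in> Lp_loc p" "AE t in lborel. \<forall>x\<in>K. norm (g (t, x)) \<le> n t"
      using SC_bound[OF g K] by blast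
    have "AE t in lborel. \<forall>x\<in>K. norm (g (t, x) - f (t, x)) \<le> n t + m t"
      using m(2) n(2)
    proof eventually_elim
      case (elim t)
      then show ?case by (auto intro: order_trans[OF norm_triangle_ineq4 add_mono])
    qed
    then show ?thesis
      by (intro bexI[where x = "\<lambda>t. n t + m t"] Lp_loc_add n(1) m(1))
  qed
  moreover have "AE t in lborel. continuous_on UNIV (\<lambda>x. f (t, x))"
    "AE t in lborel. continuous_on UNIV (\<lambda>x. g (t, x))"
    using assms by (auto simp: SC_def)
  then have "AE t in lborel. continuous_on UNIV (\<lambda>x. g (t, x) - f (t, x))"
    by eventually_elim (intro continuous_intros)
  moreover have "(\<lambda>z. g z - f z) \<in> borel_measurable borel"
    by measurable
  ultimately show ?thesis
    unfolding SC_def by auto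
qed

text \<open>The curve \<open>y\<close> is arbitrary off the interval, so it need not be Borel.
  Cutting it off by the indicator makes it Borel on the whole line, and the outer indicator hides
  the change.\<close>

lemma set_borel_measurable_superposition:
  fixes f :: "real \<times> 'a::euclidean_space \<Rightarrow> 'b::euclidean_space"
  assumes [measurable]: "f \<in> borel_measurable borel" and y: "continuous_on {a..b} y"
  shows "set_borel_measurable lborel {a..b} (\<lambda>t. f (t, y t))"
proof -
  have [measurable]: "(\<lambda>t. indicator {a..b} t *\<^sub>R y t) \<in> borel_measurable borel"
    using y by (intro borel_measurable_continuous_on_indicator) auto
  have [measurable]: "(\<lambda>t. (t, indicator {a..b} t *\<^sub>R y t)) \<in> borel \<rightarrow>\<^sub>M borel"
    by (intro borel_measurable_Pair) auto
  have "(\<lambda>t. indicator {a..b} t *\<^sub>R f (t, indicator {a..b} t *\<^sub>R y t)) \<in> borel_measurable borel"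
    by measurable
  also have "(\<lambda>t. indicator {a..b} t *\<^sub>R f (t, indicator {a..b} t *\<^sub>R y t)) =
      (\<lambda>t. indicator {a..b} t *\<^sub>R f (t, y t))"
    by (auto simp: indicator_def)
  finally show ?thesis
    by (simp add: set_borel_measurable_def)
qed

text \<open>The dominating function of the compact set \<open>K\<close> bounds the integrand along
  every curve in \<open>K\<close> at once. Hence \<open>C\<close> does not depend on the curve,
  which later makes the suprema finite.\<close>

lemma SC_superposition_bound:
  fixes f :: "real \<times> 'a::euclidean_space \<Rightarrow> 'b::euclidean_space"
  assumes f: "f \<in> SC p" and K: "compact K"
  obtains C where
    "\<And>y. continuous_on {a..b} y \<Longrightarrow> y ` {a..b} \<subseteq> K \<Longrightarrow>
      set_integrable lborel {a..b} (\<lambda>t. norm (f (t, y t)) ^ p)"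
    "\<And>y. continuous_on {a..b} y \<Longrightarrow> y ` {a..b} \<subseteq> K \<Longrightarrow>
      (LINT t:{a..b}|lborel. norm (f (t, y t)) ^ p) \<le> C"
proof -
  have [measurable]: "f \<in> borel_measurable borel"
    using f by (simp add: SC_def)
  obtain m where m: "m \<in> Lp_loc p" and "AE t in lborel. \<forall>x\<in>K. norm (f (t, x)) \<le> m t"
    using SC_bound[OF f K] by blast
  \<comment> \<open>The function \<open>m\<close> is only Lebesgue measurable, so the comparison
    takes place in the completed measure. The superposition is Borel, hence its integrability and
    its integral are the same for \<open>lborel\<close>.\<close>
  then have ae: "AE t in lebesgue. \<forall>x\<in>K. norm (f (t, x)) \<le> m t"
    by (intro AE_completion)
  have "integrable (lebesgue_on {a..b}) (\<lambda>t. \<bar>m t\<bar> ^ p)"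
    using m by (auto simp: Lp_loc_def)
  then have int: "integrable lebesgue (\<lambda>t. indicator {a..b} t *\<^sub>R \<bar>m t\<bar> ^ p)"
    by (subst (asm) integrable_restrict_space) auto
  have *: "set_integrable lborel {a..b} (\<lambda>t. norm (f (t, y t)) ^ p)
      \<and> (LINT t:{a..b}|lborel. norm (f (t, y t)) ^ p)
        \<le> integral\<^sup>L lebesgue (\<lambda>t. indicator {a..b} t *\<^sub>R \<bar>m t\<bar> ^ p)"
    if y: "continuous_on {a..b} y" "y ` {a..b} \<subseteq> K" for y
  proof -
    let ?h = "\<lambda>t. indicator {a..b} t *\<^sub>R norm (f (t, y t)) ^ p"
    have meas: "?h \<in> borel_measurable lborel"
      using set_borel_measurable_superposition[where f = "\<lambda>z. norm (f z) ^ p", OF _ y(1)]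
      by (simp add: set_borel_measurable_def)
    have le: "AE t in lebesgue. ?h t \<le> indicator {a..b} t *\<^sub>R \<bar>m t\<bar> ^ p"
      using ae
    proof eventually_elim
      case (elim t)
      show ?case
      proof (cases "t \<in> {a..b}")
        case True
        then have "norm (f (t, y t)) \<le> m t" using elim y(2) by blast
        also have "m t \<le> \<bar>m t\<bar>" by (rule abs_ge_self)
        finally have "norm (f (t, y t)) ^ p \<le> \<bar>m t\<bar> ^ p" by (rule power_mono) simp
        then show ?thesis using True by simp
      qed simp
    qed
    have h: "integrable lebesgue ?h"
    proof (rule Bochner_Integration.integrable_bound[OF int])
      show "?h \<in> borel_measurable lebesgue"
        by (rule measurable_completion[OF meas])
      show "AE t in lebesgue. norm (?h t) \<le> norm (indicator {a..b} t *\<^sub>R \<bar>m t\<bar> ^ p)"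
        using le by eventually_elim simp
    qed
    show ?thesis
      unfolding set_integrable_def set_lebesgue_integral_def
      using integrable_completion[OF meas] integral_completion[OF meas] h
        integral_mono_AE[OF h int le]
      by simp
  qed
  then show thesis using that by blast
qed

text \<open>The image of the interval under \<open>y\<close> is compact and can serve as the set
  \<open>K\<close> of the domination.\<close>

lemma SC_superposition_integrable:
  fixes f :: "real \<times> 'a::euclidean_space \<Rightarrow> 'b::euclidean_space"
  assumes f: "f \<in> SC 1" and y: "continuous_on {a..b} y"
  shows "set_integrable lborel {a..b} (\<lambda>t. f (t, y t))"
proof -
  have "compact (y ` {a..b})"
    using y by (intro compact_continuous_image) auto
  then have "set_integrable lborel {a..b} (\<lambda>t. norm (f (t, y t)) ^ 1)"
    using SC_superposition_bound[OF f] y by blast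
  moreover have "set_borel_measurable lborel {a..b} (\<lambda>t. f (t, y t))"
    using f y by (intro set_borel_measurable_superposition) (auto simp: SC_def)
  ultimately show ?thesis
    by (simp add: set_integrable_def set_borel_measurable_def flip: integrable_norm_iff)
qed

lemma SC_space_elem: "f \<in> F \<Longrightarrow> F \<in> SC_space p \<Longrightarrow> f \<in> SC p"
  using in_quotient_imp_subset[OF SC_eq_equiv] by (auto simp: SC_space_def)

lemma SC_space_nonempty: "F \<in> SC_space p \<Longrightarrow> F \<noteq> {}"
  using in_quotient_imp_non_empty[OF SC_eq_equiv] by (auto simp: SC_space_def)

section \<open>Moduli of continuity and admissible curves\<close>

lemma rational_intervals_nonempty: "rational_intervals \<noteq> {}"
  unfolding rational_intervals_def using Rats_0 by blast

lemma rational_intervals_shift: "I \<in> rational_intervals \<Longrightarrow> shift_back I \<in> rational_intervals"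
proof -
  assume "I \<in> rational_intervals"
  then obtain a b where I: "I = {a..b}" "a \<in> \<rat>" "b \<in> \<rat>" "a \<le> b"
    by (auto simp: rational_intervals_def)
  have "shift_back I = {a - 1..b - 1}"
    using image_add_atLeastAtMost'[of "-1" a b] I by simp
  then show ?thesis
    using I by (auto simp: rational_intervals_def)
qed

lemma suitable_moduliD:
  assumes "suitable_moduli \<theta>" "I \<in> rational_intervals"
  shows "s \<ge> 0 \<Longrightarrow> \<theta> I j s \<ge> 0"
    and "0 \<le> r \<Longrightarrow> r \<le> s \<Longrightarrow> \<theta> I j r \<le> \<theta> I j s"
    and "J \<in> rational_intervals \<Longrightarrow> I \<subseteq> J \<Longrightarrow> s \<ge> 0 \<Longrightarrow> \<theta> I j s \<le> \<theta> J j s"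
proof -
  have I: "\<theta> I j ` {0..} \<subseteq> {0..}" "mono_on {0..} (\<theta> I j)"
    using assms unfolding suitable_moduli_def by blast+
  show "s \<ge> 0 \<Longrightarrow> \<theta> I j s \<ge> 0" using I(1) by auto
  show "0 \<le> r \<Longrightarrow> r \<le> s \<Longrightarrow> \<theta> I j r \<le> \<theta> I j s" using monotone_onD[OF I(2)] by simp
  show "J \<in> rational_intervals \<Longrightarrow> I \<subseteq> J \<Longrightarrow> s \<ge> 0 \<Longrightarrow> \<theta> I j s \<le> \<theta> J j s"
    using assms unfolding suitable_moduli_def by blast
qed

lemma modulus_set_const:
  assumes "suitable_moduli \<theta>" "I \<in> rational_intervals" "norm c \<le> real j"
  shows "(\<lambda>_. c) \<in> modulus_set \<theta> I j"
  using suitable_moduliD(1)[OF assms(1,2)] assms(3) by (auto simp: modulus_set_def)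

lemma modulus_set_nonempty:
  assumes "suitable_moduli \<theta>" "I \<in> rational_intervals"
  shows "modulus_set \<theta> I j \<noteq> {}"
proof -
  have "(\<lambda>_. 0) \<in> modulus_set \<theta> I j"
    using assms by (intro modulus_set_const) auto
  then show ?thesis by blast
qed

text \<open>Neither a time change \<open>\<phi>\<close> with Lipschitz constant 1 nor a nonexpansive
  map \<open>L\<close> enlarges increments. Monotonicity of the modulus in its argument absorbs
  \<open>\<phi>\<close>, and monotonicity in the interval passes from \<open>I\<close> to
  \<open>J\<close>. The intended \<open>\<phi>\<close> freezes a curve at an endpoint, and the
  intended \<open>L\<close> are the two projections.\<close>

lemma modulus_set_nonexpansive:
  fixes x :: "real \<Rightarrow> 'c::euclidean_space" and L :: "'c \<Rightarrow> 'd::euclidean_space"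
  assumes \<theta>: "suitable_moduli \<theta>" and I: "I \<in> rational_intervals" and J: "J \<in> rational_intervals"
    and "I \<subseteq> J" and x: "x \<in> modulus_set \<theta> I j"
    and \<phi>: "\<phi> ` J \<subseteq> I" "\<And>s t. \<bar>\<phi> t - \<phi> s\<bar> \<le> \<bar>t - s\<bar>"
    and L: "\<And>v. norm (L v) \<le> norm v" "\<And>v w. norm (L v - L w) \<le> norm (v - w)"
  shows "(\<lambda>t. L (x (\<phi> t))) \<in> modulus_set \<theta> J j"
proof -
  have "1-lipschitz_on J \<phi>"
    using \<phi>(2) by (intro lipschitz_onI) (auto simp: dist_norm)
  then have cont_\<phi>: "continuous_on J \<phi>"
    by (rule lipschitz_on_continuous_on)
  have "1-lipschitz_on UNIV L"
    using L(2) by (intro lipschitz_onI) (auto simp: dist_norm)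
  then have cont_L: "continuous_on UNIV L"
    by (rule lipschitz_on_continuous_on)
  have cont_x: "continuous_on I x" and bound: "x ` I \<subseteq> cball 0 (real j)"
    and mod: "\<And>s t. s \<in> I \<Longrightarrow> t \<in> I \<Longrightarrow> norm (x t - x s) \<le> \<theta> I j \<bar>t - s\<bar>"
    using x by (simp_all add: modulus_set_def)
  have "continuous_on J (\<lambda>t. L (x (\<phi> t)))"
    by (rule continuous_on_compose2[OF cont_L continuous_on_compose2[OF cont_x cont_\<phi> \<phi>(1)]]) simp
  moreover have "norm (L (x (\<phi> t))) \<le> real j" if "t \<in> J" for t
  proof -
    have "x (\<phi> t) \<in> cball 0 (real j)" using bound \<phi>(1) that by blast
    then have "norm (x (\<phi> t)) \<le> real j" by simp
    with L(1) show ?thesis by (rule order_trans)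
  qed
  moreover have "norm (L (x (\<phi> t)) - L (x (\<phi> s))) \<le> \<theta> J j \<bar>t - s\<bar>" if "s \<in> J" "t \<in> J" for s t
  proof -
    have "norm (L (x (\<phi> t)) - L (x (\<phi> s))) \<le> norm (x (\<phi> t) - x (\<phi> s))" by (rule L)
    also have "\<dots> \<le> \<theta> I j \<bar>\<phi> t - \<phi> s\<bar>" using mod that \<phi>(1) by blast
    also have "\<dots> \<le> \<theta> I j \<bar>t - s\<bar>"
      using \<phi>(2) by (intro suitable_moduliD(2)[OF \<theta> I]) auto
    also have "\<dots> \<le> \<theta> J j \<bar>t - s\<bar>"
      using J \<open>I \<subseteq> J\<close> by (intro suitable_moduliD(3)[OF \<theta> I]) auto
    finally show ?thesis .
  qed
  ultimately show ?thesis by (auto simp: modulus_set_def)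
qed

text \<open>Merging the two curves into one curve in the product space lets the results on
  superposition with a single curve serve the delayed seminorms as well.\<close>

definition delayed_pair :: "(real \<Rightarrow> 'a) \<Rightarrow> (real \<Rightarrow> 'a) \<Rightarrow> real \<Rightarrow> 'a \<times> 'a" where
  "delayed_pair x u t = (x t, u (t - 1))"

text \<open>The norm of a pair may reach \<open>j\<close> times the square root of 2, so the compact
  set confining the merged curve is a product of balls and not the ball of radius
  \<open>j\<close>.\<close>

lemma delayed_pair_continuous:
  assumes "x \<in> modulus_set \<theta> I j" "u \<in> modulus_set \<theta> (shift_back I) j"
  shows "continuous_on I (delayed_pair x u)"
    and "delayed_pair x u ` I \<subseteq> cball 0 (real j) \<times> cball 0 (real j)"
proof -
  have x: "continuous_on I x" "x ` I \<subseteq> cball 0 (real j)"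
    and u: "continuous_on (shift_back I) u" "u ` shift_back I \<subseteq> cball 0 (real j)"
    using assms by (simp_all add: modulus_set_def)
  have "continuous_on I (\<lambda>t. u (t - 1))"
    by (rule continuous_on_compose2[OF u(1)]) (auto intro: continuous_intros)
  then show "continuous_on I (delayed_pair x u)"
    unfolding delayed_pair_def[abs_def] by (intro continuous_on_Pair x(1))
  show "delayed_pair x u ` I \<subseteq> cball 0 (real j) \<times> cball 0 (real j)"
    using x(2) u(2) by (auto simp: delayed_pair_def image_subset_iff)
qed

text \<open>Moduli are comparable only for nested intervals. Lengthening by one unit is what makes
  the shifted interval \<open>{a - 1..b}\<close> contain \<open>{a..b}\<close>, so that the modulus
  of \<open>x\<close> is dominated there too.\<close>

lemma delayed_extension:
  fixes x :: "real \<Rightarrow> 'a::euclidean_space \<times> 'a"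
  assumes \<theta>: "suitable_moduli \<theta>" and ab: "a \<in> \<rat>" "b \<in> \<rat>" "a \<le> b"
    and x: "x \<in> modulus_set \<theta> {a..b} j"
  obtains y u where "y \<in> modulus_set \<theta> {a..b + 1} j" "u \<in> modulus_set \<theta> (shift_back {a..b + 1}) j"
    "\<And>t. t \<in> {a..b} \<Longrightarrow> delayed_pair y u t = x t"
    "\<And>t. t \<in> {b..b + 1} \<Longrightarrow> delayed_pair y u t = x b"
proof
  have I: "{a..b} \<in> rational_intervals" "{a..b + 1} \<in> rational_intervals"
    using ab by (auto simp: rational_intervals_def)
  have shift: "shift_back {a..b + 1} = {a - 1..b}"
    using image_add_atLeastAtMost'[of "-1" a "b + 1"] by simp
  have J: "{a - 1..b} \<in> rational_intervals"
    using rational_intervals_shift[OF I(2)] shift by simp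
  \<comment> \<open>The advance by 1 in \<open>?u\<close> cancels the delay, and \<open>min\<close>
    freezes both components at the value for time \<open>b\<close>. For arguments in the respective
    domains the inner time stays in \<open>{a..b}\<close>.\<close>
  let ?y = "\<lambda>t. fst (x (min t b))" and ?u = "\<lambda>t. snd (x (min (t + 1) b))"
  show "?y \<in> modulus_set \<theta> {a..b + 1} j"
    using ab by (intro modulus_set_nonexpansive[OF \<theta> I _ x])
      (auto simp: norm_fst_le simp flip: fst_diff)
  show "?u \<in> modulus_set \<theta> (shift_back {a..b + 1}) j"
    unfolding shift using ab by (intro modulus_set_nonexpansive[OF \<theta> I(1) J _ x])
      (auto simp: norm_snd_le simp flip: snd_diff)
  show "delayed_pair ?y ?u t = x t" if "t \<in> {a..b}" for t
    using that by (simp add: delayed_pair_def)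
  show "delayed_pair ?y ?u t = x b" if "t \<in> {b..b + 1}" for t
    using that by (simp add: delayed_pair_def)
qed

section \<open>Finiteness and triangle inequality of the seminorms\<close>

text \<open>A real supremum bounds its members only if the set is bounded above. The bound that is
  uniform over curves in \<open>K\<close> ensures this, since the root is monotone.\<close>

lemma bdd_above_root_LINT:
  fixes f :: "real \<times> 'a::euclidean_space \<Rightarrow> 'b::euclidean_space"
  assumes "p \<ge> 1" "f \<in> SC p" "compact K"
    and Y: "\<And>y. y \<in> Y \<Longrightarrow> continuous_on {a..b} y \<and> y ` {a..b} \<subseteq> K"
  shows "bdd_above ((\<lambda>y. root p (LINT t:{a..b}|lborel. norm (f (t, y t)) ^ p)) ` Y)"
proof -
  obtain C where "\<And>y. y \<in> Y \<Longrightarrow> (LINT t:{a..b}|lborel. norm (f (t, y t)) ^ p) \<le> C"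
    using SC_superposition_bound[OF assms(2,3)] Y by metis
  then show ?thesis
    using \<open>p \<ge> 1\<close> by (intro bdd_aboveI2[where M = "root p C"]) simp
qed

lemma bdd_above_norm_LINT:
  fixes f :: "real \<times> 'a::euclidean_space \<Rightarrow> 'b::euclidean_space"
  assumes "f \<in> SC 1" "compact K"
    and Y: "\<And>y. y \<in> Y \<Longrightarrow> continuous_on {a..b} y \<and> y ` {a..b} \<subseteq> K"
  shows "bdd_above ((\<lambda>y. norm (LINT t:{a..b}|lborel. f (t, y t))) ` Y)"
proof -
  \<comment> \<open>Exponent 1 bounds the integrals of the norm, and these dominate the norms of the
    integrals.\<close>
  have "bdd_above ((\<lambda>y. root 1 (LINT t:{a..b}|lborel. norm (f (t, y t)) ^ 1)) ` Y)"
    using assms by (intro bdd_above_root_LINT) auto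
  then obtain C where C: "\<And>y. y \<in> Y \<Longrightarrow> (LINT t:{a..b}|lborel. norm (f (t, y t))) \<le> C"
    by (auto simp: bdd_above_def)
  show ?thesis
  proof (rule bdd_aboveI2)
    fix y assume "y \<in> Y"
    then have "set_integrable lborel {a..b} (\<lambda>t. f (t, y t))"
      using Y SC_superposition_integrable[OF assms(1)] by blast
    then show "norm (LINT t:{a..b}|lborel. f (t, y t)) \<le> C"
      using C[OF \<open>y \<in> Y\<close>] by (rule order_trans[OF set_integral_norm_bound])
  qed
qed

context
  fixes \<theta> :: "real set \<Rightarrow> nat \<Rightarrow> real \<Rightarrow> real" and I :: "real set" and j :: nat
  assumes \<theta>: "suitable_moduli \<theta>" and I: "I \<in> rational_intervals"
begin

lemma seminorm_T_upper:
  assumes "p \<ge> 1" "f \<in> SC p" "x \<in> modulus_set \<theta> I j"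
  shows "root p (LINT t:I|lborel. norm (f (t, x t)) ^ p) \<le> seminorm_T \<theta> p I j f"
  unfolding seminorm_T_def using I assms
  by (auto intro!: cSUP_upper bdd_above_root_LINT[where K = "cball 0 (real j)"]
      simp: rational_intervals_def modulus_set_def)

lemma seminorm_sigma_upper:
  assumes "f \<in> SC 1" "x \<in> modulus_set \<theta> I j"
  shows "norm (LINT t:I|lborel. f (t, x t)) \<le> seminorm_sigma \<theta> I j f"
  unfolding seminorm_sigma_def using I assms
  by (auto intro!: cSUP_upper bdd_above_norm_LINT[where K = "cball 0 (real j)"]
      simp: rational_intervals_def modulus_set_def)

lemma seminorm_TT_upper:
  fixes f :: "real \<times> 'a::euclidean_space \<times> 'a \<Rightarrow> 'b::euclidean_space"
  assumes "p \<ge> 1" "f \<in> SC p" "x \<in> modulus_set \<theta> I j" "u \<in> modulus_set \<theta> (shift_back I) j"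
  shows "root p (LINT t:I|lborel. norm (f (t, delayed_pair x u t)) ^ p) \<le> seminorm_TT \<theta> p I j f"
proof -
  \<comment> \<open>Passing to the set of merged curves turns the supremum over pairs into one over
    single curves, to which the boundedness lemma applies.\<close>
  let ?Y = "case_prod delayed_pair ` (modulus_set \<theta> I j \<times> modulus_set \<theta> (shift_back I) j)"
  let ?K = "cball 0 (real j) \<times> cball 0 (real j) :: ('a \<times> 'a) set"
  obtain a b where ab: "I = {a..b}" using I by (auto simp: rational_intervals_def)
  have "compact ?K" by (intro compact_Times compact_cball)
  moreover have "continuous_on {a..b} y \<and> y ` {a..b} \<subseteq> ?K" if "y \<in> ?Y" for y
    using that delayed_pair_continuous unfolding ab by (fastforce simp del: image_subset_iff)
  ultimately have "bdd_above ((\<lambda>y. root p (LINT t:I|lborel. norm (f (t, y t)) ^ p)) ` ?Y)"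
    unfolding ab by (rule bdd_above_root_LINT[OF assms(1,2)])
  moreover have "seminorm_TT \<theta> p I j f = (SUP y\<in>?Y. root p (LINT t:I|lborel. norm (f (t, y t)) ^ p))"
    by (simp add: seminorm_TT_def image_image case_prod_beta delayed_pair_def)
  ultimately show ?thesis
    using assms(3,4) by (auto intro!: cSUP_upper)
qed

lemma seminorm_sigma_sigma_upper:
  fixes f :: "real \<times> 'a::euclidean_space \<times> 'a \<Rightarrow> 'b::euclidean_space"
  assumes "f \<in> SC 1" "x \<in> modulus_set \<theta> I j" "u \<in> modulus_set \<theta> (shift_back I) j"
  shows "norm (LINT t:I|lborel. f (t, delayed_pair x u t)) \<le> seminorm_sigma_sigma \<theta> I j f"
proof -
  let ?Y = "case_prod delayed_pair ` (modulus_set \<theta> I j \<times> modulus_set \<theta> (shift_back I) j)"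
  let ?K = "cball 0 (real j) \<times> cball 0 (real j) :: ('a \<times> 'a) set"
  obtain a b where ab: "I = {a..b}" using I by (auto simp: rational_intervals_def)
  have "compact ?K" by (intro compact_Times compact_cball)
  moreover have "continuous_on {a..b} y \<and> y ` {a..b} \<subseteq> ?K" if "y \<in> ?Y" for y
    using that delayed_pair_continuous unfolding ab by (fastforce simp del: image_subset_iff)
  ultimately have "bdd_above ((\<lambda>y. norm (LINT t:I|lborel. f (t, y t))) ` ?Y)"
    unfolding ab by (rule bdd_above_norm_LINT[OF assms(1)])
  moreover have "seminorm_sigma_sigma \<theta> I j f = (SUP y\<in>?Y. norm (LINT t:I|lborel. f (t, y t)))"
    by (simp add: seminorm_sigma_sigma_def image_image case_prod_beta delayed_pair_def)
  ultimately show ?thesis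
    using assms(2,3) by (auto intro!: cSUP_upper)
qed

lemma seminorms_zero:
  shows "p \<ge> 1 \<Longrightarrow> seminorm_T \<theta> p I j (\<lambda>z. 0) = 0"
    and "p \<ge> 1 \<Longrightarrow> seminorm_TT \<theta> p I j (\<lambda>z. 0) = 0"
    and "seminorm_sigma \<theta> I j (\<lambda>z. 0) = 0"
    and "seminorm_sigma_sigma \<theta> I j (\<lambda>z. 0) = 0"
  by (simp_all add: modulus_set_nonempty[OF \<theta> I]
      modulus_set_nonempty[OF \<theta> rational_intervals_shift[OF I]]
      seminorm_T_def seminorm_TT_def seminorm_sigma_def seminorm_sigma_sigma_def
      set_lebesgue_integral_def case_prod_beta power_0_left)

text \<open>Minkowski's inequality holds along each curve, and each of its two terms is at most the
  corresponding supremum.\<close>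

lemma seminorm_T_triangle:
  assumes p: "p \<ge> 1" and f: "f \<in> SC p" and g: "g \<in> SC p"
  shows "seminorm_T \<theta> p I j (\<lambda>z. f z + g z) \<le> seminorm_T \<theta> p I j f + seminorm_T \<theta> p I j g"
  unfolding seminorm_T_def[of _ _ _ _ "\<lambda>z. f z + g z"]
proof (rule cSUP_least[OF modulus_set_nonempty[OF \<theta> I]])
  fix x :: "real \<Rightarrow> 'a \<times> 'a" assume x: "x \<in> modulus_set \<theta> I j"
  have "set_integrable lborel I (\<lambda>t. norm (h (t, x t)) ^ p)" if "h \<in> SC p" for h :: "_ \<Rightarrow> 'b"
  proof -
    obtain a b where ab: "I = {a..b}" using I by (auto simp: rational_intervals_def)
    have "compact (cball 0 (real j) :: ('a \<times> 'a) set)" by simp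
    from SC_superposition_bound[OF that this] show ?thesis
      using x unfolding ab modulus_set_def by blast
  qed
  then show "root p (LINT t:I|lborel. norm (f (t, x t) + g (t, x t)) ^ p)
      \<le> seminorm_T \<theta> p I j f + seminorm_T \<theta> p I j g"
    using Minkowski_set_integral[OF p, of lborel I "\<lambda>t. f (t, x t)" "\<lambda>t. g (t, x t)"]
      seminorm_T_upper[OF p f x] seminorm_T_upper[OF p g x] f g by fastforce
qed

lemma seminorm_sigma_triangle:
  assumes f: "f \<in> SC 1" and g: "g \<in> SC 1"
  shows "seminorm_sigma \<theta> I j (\<lambda>z. f z + g z) \<le> seminorm_sigma \<theta> I j f + seminorm_sigma \<theta> I j g"
  unfolding seminorm_sigma_def[of _ _ _ "\<lambda>z. f z + g z"]
proof (rule cSUP_least[OF modulus_set_nonempty[OF \<theta> I]])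
  fix x :: "real \<Rightarrow> 'a \<times> 'a" assume x: "x \<in> modulus_set \<theta> I j"
  have "set_integrable lborel I (\<lambda>t. f (t, x t))" "set_integrable lborel I (\<lambda>t. g (t, x t))"
    using I x SC_superposition_integrable[OF f] SC_superposition_integrable[OF g]
    by (auto simp: rational_intervals_def modulus_set_def)
  then have "(LINT t:I|lborel. f (t, x t) + g (t, x t)) =
      (LINT t:I|lborel. f (t, x t)) + (LINT t:I|lborel. g (t, x t))"
    by (rule set_integral_add)
  then show "norm (LINT t:I|lborel. f (t, x t) + g (t, x t))
      \<le> seminorm_sigma \<theta> I j f + seminorm_sigma \<theta> I j g"
    using seminorm_sigma_upper[OF f x] seminorm_sigma_upper[OF g x]
    by (auto intro: order_trans[OF norm_triangle_ineq] add_mono)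
qed

end

section \<open>Domination by the delayed seminorms\<close>

lemma seminorm_T_le_TT:
  fixes f :: "real \<times> 'a::euclidean_space \<times> 'a \<Rightarrow> 'b::euclidean_space"
  assumes \<theta>: "suitable_moduli \<theta>" and ab: "a \<in> \<rat>" "b \<in> \<rat>" "a \<le> b"
    and p: "p \<ge> 1" and f: "f \<in> SC p"
  shows "seminorm_T \<theta> p {a..b} j f \<le> seminorm_TT \<theta> p {a..b + 1} j f"
proof -
  have I: "{a..b} \<in> rational_intervals" "{a..b + 1} \<in> rational_intervals"
    using ab by (auto simp: rational_intervals_def)
  show ?thesis
    unfolding seminorm_T_def
  proof (rule cSUP_least[OF modulus_set_nonempty[OF \<theta> I(1)]])
    fix x :: "real \<Rightarrow> 'a \<times> 'a" assume "x \<in> modulus_set \<theta> {a..b} j"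
    then obtain y u where yu: "y \<in> modulus_set \<theta> {a..b + 1} j"
      "u \<in> modulus_set \<theta> (shift_back {a..b + 1}) j"
      and eq: "\<And>t. t \<in> {a..b} \<Longrightarrow> delayed_pair y u t = x t"
      using delayed_extension[OF \<theta> ab] by metis
    let ?h = "\<lambda>t. norm (f (t, delayed_pair y u t)) ^ p"
    have "compact (cball 0 (real j) \<times> cball 0 (real j) :: ('a \<times> 'a) set)"
      by (intro compact_Times) auto
    from SC_superposition_bound[OF f this]
    have int: "set_integrable lborel {a..b + 1} ?h"
      using delayed_pair_continuous[OF yu] by blast
    have "(LINT t:{a..b}|lborel. norm (f (t, x t)) ^ p) = (LINT t:{a..b}|lborel. ?h t)"
      using eq by (intro set_lebesgue_integral_cong) auto
    \<comment> \<open>The integrand is nonnegative, so the added piece of the interval cannot lower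
      the integral.\<close>
    also have "\<dots> \<le> (LINT t:{a..b + 1}|lborel. ?h t)"
      using int unfolding set_lebesgue_integral_def set_integrable_def
      by (intro integral_mono_AE') (auto simp: indicator_def)
    finally have "root p (LINT t:{a..b}|lborel. norm (f (t, x t)) ^ p)
        \<le> root p (LINT t:{a..b + 1}|lborel. ?h t)"
      using p by simp
    also have "\<dots> \<le> seminorm_TT \<theta> p {a..b + 1} j f"
      by (rule seminorm_TT_upper[OF \<theta> I(2) p f yu])
    finally show "root p (LINT t:{a..b}|lborel. norm (f (t, x t)) ^ p)
        \<le> seminorm_TT \<theta> p {a..b + 1} j f" .
  qed
qed

text \<open>Cancellation prevents monotonicity in the interval, so the integral over
  \<open>{b..b + 1}\<close> has to be subtracted again. There the extended curve is frozen at
  \<open>x b\<close>, which a seminorm on that interval controls.\<close>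

lemma seminorm_sigma_le_sigma_sigma:
  fixes f :: "real \<times> 'a::euclidean_space \<times> 'a \<Rightarrow> 'b::euclidean_space"
  assumes \<theta>: "suitable_moduli \<theta>" and ab: "a \<in> \<rat>" "b \<in> \<rat>" "a \<le> b" and f: "f \<in> SC 1"
  shows "seminorm_sigma \<theta> {a..b} j f
    \<le> seminorm_sigma_sigma \<theta> {a..b + 1} j f + seminorm_sigma_sigma \<theta> {b..b + 1} j f"
proof -
  have I: "{a..b} \<in> rational_intervals" "{a..b + 1} \<in> rational_intervals"
    and J: "{b..b + 1} \<in> rational_intervals"
    using ab by (auto simp: rational_intervals_def)
  show ?thesis
    unfolding seminorm_sigma_def
  proof (rule cSUP_least[OF modulus_set_nonempty[OF \<theta> I(1)]])
    fix x :: "real \<Rightarrow> 'a \<times> 'a" assume x: "x \<in> modulus_set \<theta> {a..b} j"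
    then obtain y u where yu: "y \<in> modulus_set \<theta> {a..b + 1} j"
      "u \<in> modulus_set \<theta> (shift_back {a..b + 1}) j"
      and eq: "\<And>t. t \<in> {a..b} \<Longrightarrow> delayed_pair y u t = x t"
        "\<And>t. t \<in> {b..b + 1} \<Longrightarrow> delayed_pair y u t = x b"
      using delayed_extension[OF \<theta> ab] by metis
    \<comment> \<open>Constant curves satisfy every modulus, so this pair is admissible on
      \<open>{b..b + 1}\<close> whatever the moduli attached to that interval and its shift
      are.\<close>
    let ?c = "delayed_pair (\<lambda>_. fst (x b)) (\<lambda>_. snd (x b))"
    let ?h = "\<lambda>t. f (t, delayed_pair y u t)"
    have "x ` {a..b} \<subseteq> cball 0 (real j)"
      using x by (simp add: modulus_set_def)
    moreover have "x b \<in> x ` {a..b}"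
      using ab(3) by simp
    ultimately have "x b \<in> cball 0 (real j)" by (rule subsetD)
    then have "norm (x b) \<le> real j" by simp
    then have c: "norm (fst (x b)) \<le> real j" "norm (snd (x b)) \<le> real j"
      by (metis norm_fst_le norm_snd_le order_trans prod.collapse)+
    have "continuous_on {a..b + 1} (delayed_pair y u)"
      by (rule delayed_pair_continuous[OF yu])
    then have "set_integrable lborel {a..b + 1} ?h"
      by (rule SC_superposition_integrable[OF f])
    then have int: "set_integrable lborel {a..b} ?h" "set_integrable lborel {b..b + 1} ?h"
      using ab by (auto elim!: set_integrable_subset)
    have "{a..b + 1} = {a..b} \<union> {b..b + 1}"
      using ab by auto
    \<comment> \<open>The two pieces share the endpoint \<open>b\<close>, which is a null set, so
      additivity of the integral survives.\<close>
    moreover have "AE t in lborel. \<not> (t \<in> {a..b} \<and> t \<in> {b..b + 1})"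
      using AE_lborel_singleton[of b] by eventually_elim auto
    ultimately have "(LINT t:{a..b + 1}|lborel. ?h t) =
        (LINT t:{a..b}|lborel. ?h t) + (LINT t:{b..b + 1}|lborel. ?h t)"
      using int by (simp add: set_integral_Un_AE)
    moreover have "(LINT t:{a..b}|lborel. ?h t) = (LINT t:{a..b}|lborel. f (t, x t))"
      using eq by (intro set_lebesgue_integral_cong) auto
    moreover have "(LINT t:{b..b + 1}|lborel. ?h t) = (LINT t:{b..b + 1}|lborel. f (t, ?c t))"
      using eq by (intro set_lebesgue_integral_cong) (auto simp: delayed_pair_def)
    ultimately have "(LINT t:{a..b}|lborel. f (t, x t)) =
        (LINT t:{a..b + 1}|lborel. ?h t) - (LINT t:{b..b + 1}|lborel. f (t, ?c t))"
      by simp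
    then have "norm (LINT t:{a..b}|lborel. f (t, x t)) \<le>
        norm (LINT t:{a..b + 1}|lborel. ?h t) + norm (LINT t:{b..b + 1}|lborel. f (t, ?c t))"
      by (simp add: norm_triangle_ineq4)
    moreover have "norm (LINT t:{a..b + 1}|lborel. ?h t) \<le> seminorm_sigma_sigma \<theta> {a..b + 1} j f"
      by (rule seminorm_sigma_sigma_upper[OF \<theta> I(2) f yu])
    moreover have "norm (LINT t:{b..b + 1}|lborel. f (t, ?c t)) \<le> seminorm_sigma_sigma \<theta> {b..b + 1} j f"
      using c by (intro seminorm_sigma_sigma_upper[OF \<theta> J f] modulus_set_const[OF \<theta>]
          rational_intervals_shift J)
    ultimately show "norm (LINT t:{a..b}|lborel. f (t, x t))
        \<le> seminorm_sigma_sigma \<theta> {a..b + 1} j f + seminorm_sigma_sigma \<theta> {b..b + 1} j f"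
      by linarith
  qed
qed

section \<open>The two comparisons of topologies\<close>

lemma T_Theta_coarser:
  assumes p: "p \<ge> 1" and \<theta>: "suitable_moduli \<theta>"
  shows "coarser
    (T_Theta \<theta> p :: (real \<times> 'a::euclidean_space \<times> 'a \<Rightarrow> 'b::euclidean_space) set topology)
    (T_ThetaTheta \<theta> p)"
  unfolding T_Theta_def T_ThetaTheta_def
proof (rule seminorm_topology_coarser)
  let ?S = "SC_space p :: (real \<times> 'a \<times> 'a \<Rightarrow> 'b) set set"
  let ?P = "{seminorm_T \<theta> p I j | I j. I \<in> rational_intervals} :: ((real \<times> 'a \<times> 'a \<Rightarrow> 'b) \<Rightarrow> real) set"
  let ?Q = "{seminorm_TT \<theta> p I j | I j. I \<in> rational_intervals} :: ((real \<times> 'a \<times> 'a \<Rightarrow> 'b) \<Rightarrow> real) set"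
  show "?P \<noteq> {}" "?Q \<noteq> {}"
    using rational_intervals_nonempty by blast+
  show "F \<noteq> {}" if "F \<in> ?S" for F
    by (rule SC_space_nonempty[OF that])
  show "\<rho> (\<lambda>z. g z - f z) = \<rho> (\<lambda>z. g' z - f' z)"
    if "\<rho> \<in> ?P \<union> ?Q" "F \<in> ?S" "f \<in> F" "f' \<in> F" "G \<in> ?S" "g \<in> G" "g' \<in> G" for \<rho> F G f f' g g'
    using that(1) seminorms_independent(1,2)[OF that(2-7)] by blast
  show "\<rho> (\<lambda>z. 0) = 0" if "\<rho> \<in> ?P \<union> ?Q" for \<rho>
    using that seminorms_zero(1,2)[OF \<theta> _ p] by blast
  show "\<rho> (\<lambda>z. h z - f z) \<le> \<rho> (\<lambda>z. h z - g z) + \<rho> (\<lambda>z. g z - f z)"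
    if "\<rho> \<in> ?P" and fgh: "f \<in> \<Union>?S" "g \<in> \<Union>?S" "h \<in> \<Union>?S" for \<rho> f g h
  proof -
    \<comment> \<open>The triangle inequality for sums is applied to \<open>h - f\<close> written as
      \<open>(h - g) + (g - f)\<close>.\<close>
    have "(\<lambda>z. h z - g z) \<in> SC p" "(\<lambda>z. g z - f z) \<in> SC p"
      using fgh SC_space_elem by (blast intro: SC_diff)+
    then show ?thesis
      using that(1) seminorm_T_triangle[OF \<theta> _ p] by fastforce
  qed
  show "\<exists>\<sigma>\<in>?Q. \<exists>\<tau>\<in>?Q. \<forall>f\<in>\<Union>?S. \<forall>g\<in>\<Union>?S.
      \<rho> (\<lambda>z. g z - f z) \<le> \<sigma> (\<lambda>z. g z - f z) + \<tau> (\<lambda>z. g z - f z)" if P: "\<rho> \<in> ?P" for \<rho>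
  proof -
    obtain a b j where ab: "a \<in> \<rat>" "b \<in> \<rat>" "a \<le> b" and \<rho>: "\<rho> = seminorm_T \<theta> p {a..b} j"
      using P by (auto simp: rational_intervals_def)
    have J: "{a..b + 1} \<in> rational_intervals"
      using ab by (auto simp: rational_intervals_def)
    let ?\<sigma> = "seminorm_TT \<theta> p {a..b + 1} j :: (real \<times> 'a \<times> 'a \<Rightarrow> 'b) \<Rightarrow> real"
    \<comment> \<open>A single delayed seminorm already dominates. It is repeated to fit the
      two-term form, at the price of showing that it is nonnegative.\<close>
    have "\<rho> (\<lambda>z. g z - f z) \<le> ?\<sigma> (\<lambda>z. g z - f z) + ?\<sigma> (\<lambda>z. g z - f z)"
      if "f \<in> \<Union>?S" "g \<in> \<Union>?S" for f g
    proof -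
      have d: "(\<lambda>z. g z - f z) \<in> SC p"
        using that SC_space_elem by (blast intro: SC_diff)
      \<comment> \<open>One admissible pair suffices for nonnegativity: its term is nonnegative and
        lies below the supremum.\<close>
      obtain x u :: "real \<Rightarrow> 'a" where
        "x \<in> modulus_set \<theta> {a..b + 1} j" "u \<in> modulus_set \<theta> (shift_back {a..b + 1}) j"
        using modulus_set_nonempty[OF \<theta>] J rational_intervals_shift by blast
      note seminorm_TT_upper[OF \<theta> J p d this]
      moreover have "0 \<le> root p (LINT t:{a..b + 1}|lborel.
          norm (g (t, delayed_pair x u t) - f (t, delayed_pair x u t)) ^ p)"
        by (auto simp: set_lebesgue_integral_def intro!: real_root_ge_zero integral_nonneg_AE)
      ultimately show ?thesis
        using seminorm_T_le_TT[OF \<theta> ab p d, of j] by (simp add: \<rho>)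
    qed
    moreover have "?\<sigma> \<in> ?Q" using J by blast
    ultimately show ?thesis by blast
  qed
qed

lemma sigma_Theta_coarser:
  assumes \<theta>: "suitable_moduli \<theta>"
  shows "coarser
    (sigma_Theta \<theta> :: (real \<times> 'a::euclidean_space \<times> 'a \<Rightarrow> 'b::euclidean_space) set topology)
    (sigma_ThetaTheta \<theta>)"
  unfolding sigma_Theta_def sigma_ThetaTheta_def
proof (rule seminorm_topology_coarser)
  let ?S = "SC_space 1 :: (real \<times> 'a \<times> 'a \<Rightarrow> 'b) set set"
  let ?P = "{seminorm_sigma \<theta> I j | I j. I \<in> rational_intervals} :: ((real \<times> 'a \<times> 'a \<Rightarrow> 'b) \<Rightarrow> real) set"
  let ?Q = "{seminorm_sigma_sigma \<theta> I j | I j. I \<in> rational_intervals} :: ((real \<times> 'a \<times> 'a \<Rightarrow> 'b) \<Rightarrow> real) set"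
  show "?P \<noteq> {}" "?Q \<noteq> {}"
    using rational_intervals_nonempty by blast+
  show "F \<noteq> {}" if "F \<in> ?S" for F
    by (rule SC_space_nonempty[OF that])
  show "\<rho> (\<lambda>z. g z - f z) = \<rho> (\<lambda>z. g' z - f' z)"
    if "\<rho> \<in> ?P \<union> ?Q" "F \<in> ?S" "f \<in> F" "f' \<in> F" "G \<in> ?S" "g \<in> G" "g' \<in> G" for \<rho> F G f f' g g'
    using that(1) seminorms_independent(3,4)[OF that(2-7)] by blast
  show "\<rho> (\<lambda>z. 0) = 0" if "\<rho> \<in> ?P \<union> ?Q" for \<rho>
    using that seminorms_zero(3,4)[OF \<theta>] by blast
  show "\<rho> (\<lambda>z. h z - f z) \<le> \<rho> (\<lambda>z. h z - g z) + \<rho> (\<lambda>z. g z - f z)"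
    if "\<rho> \<in> ?P" and fgh: "f \<in> \<Union>?S" "g \<in> \<Union>?S" "h \<in> \<Union>?S" for \<rho> f g h
  proof -
    have "(\<lambda>z. h z - g z) \<in> SC 1" "(\<lambda>z. g z - f z) \<in> SC 1"
      using fgh SC_space_elem by (blast intro: SC_diff)+
    then show ?thesis
      using that(1) seminorm_sigma_triangle[OF \<theta>] by fastforce
  qed
  show "\<exists>\<sigma>\<in>?Q. \<exists>\<tau>\<in>?Q. \<forall>f\<in>\<Union>?S. \<forall>g\<in>\<Union>?S.
      \<rho> (\<lambda>z. g z - f z) \<le> \<sigma> (\<lambda>z. g z - f z) + \<tau> (\<lambda>z. g z - f z)" if P: "\<rho> \<in> ?P" for \<rho>
  proof -
    obtain a b j where ab: "a \<in> \<rat>" "b \<in> \<rat>" "a \<le> b" and \<rho>: "\<rho> = seminorm_sigma \<theta> {a..b} j"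
      using P by (auto simp: rational_intervals_def)
    have "{a..b + 1} \<in> rational_intervals" "{b..b + 1} \<in> rational_intervals"
      using ab by (auto simp: rational_intervals_def)
    \<comment> \<open>Here the two dominating seminorms belong to different intervals: the extended
      one, and the added piece whose contribution has to be removed.\<close>
    moreover have "\<rho> (\<lambda>z. g z - f z) \<le> seminorm_sigma_sigma \<theta> {a..b + 1} j (\<lambda>z. g z - f z)
        + seminorm_sigma_sigma \<theta> {b..b + 1} j (\<lambda>z. g z - f z)"
      if "f \<in> \<Union>?S" "g \<in> \<Union>?S" for f g
      unfolding \<rho> using that SC_space_elem
      by (blast intro: seminorm_sigma_le_sigma_sigma[OF \<theta> ab] SC_diff)
    ultimately show ?thesis by blast
  qed
qed

theorem proposition2p13:
  fixes \<theta> :: "real set \<Rightarrow> nat \<Rightarrow> real \<Rightarrow> real" and p :: nat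
  assumes "p \<ge> 1" and "suitable_moduli \<theta>"
  shows "coarser
           (T_Theta \<theta> p :: (real \<times> (real ^ 'n) \<times> (real ^ 'n) \<Rightarrow> real ^ 'n) set topology)
           (T_ThetaTheta \<theta> p)
       \<and> coarser
           (sigma_Theta \<theta> :: (real \<times> (real ^ 'n) \<times> (real ^ 'n) \<Rightarrow> real ^ 'n) set topology)
           (sigma_ThetaTheta \<theta>)"
  using T_Theta_coarser sigma_Theta_coarser assms by blast

end
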